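(* Let $m$ be the number of alternatives and $n$ the number of preferences in the input profile. For every $0<\varepsilon_a'\le1$ and $0<\delta<1/2$ such that $\mathrm{con}_{\text{single crossing}}(\lceil(1-\varepsilon_a')m\rceil)<1$, any $(0,0,0,\varepsilon_a',\delta,\text{single crossing})$-Arbitrary Outliers vs Arbitrary Profile Tester has sample complexity $\Omega\left(n\log\frac1\delta\right)$.
   Context: Profiles. Let $\mathcal{A}$ be a finite set of $m$ alternatives and $\mathcal{L}(\mathcal{A})$ the set of linear orders (preferences) over $\mathcal{A}$; for $\mathcal{X}\subseteq\mathcal{A}$, $\succ(\mathcal{X})$ is the restriction of $\succ$ to $\mathcal{X}$. A profile is a tuple $(\succ_i)_{i\in[n]}$ of $n$ preferences over $\mathcal{A}$, one per agent. A profile is single crossing if its preferences can be ordered in a sequence such that for every pair of alternatives $x,y$ the relative order of $x$ and $y$ changes at most once along the sequence. The content $\mathrm{con}_{\text{single crossing}}$ is the function such that $\mathrm{con}_{\text{single crossing}}(k)\,k!$ is the maximum number of distinct preferences in a single crossing profile over $k$ alternatives (with the convention $\mathrm{con}_{\text{single crossing}}(0)=1$). Sampling model. An oracle, when queried, returns an agent picked uniformly at random with replacement from the set of all $n$ agents. The algorithm may then ask this agent arbitrarily many comparison queries: given two alternatives $x,y$, the agent replies which of the two it prefers. The sample complexity of an algorithm is the total number of comparison queries it makes. Problem. A $(0,0,0,\varepsilon_a',\delta,\text{single crossing})$-Arbitrary Outliers vs Arbitrary Profile Tester is a (randomized) algorithm in this model which, given a profile $(\succ_i)_{i\in[n]}$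 over $\mathcal{A}$ that is of one of the following two kinds, outputs $1$ if it is of kind (i) and $0$ if it is of kind (ii), with error probability at most $\delta$: (i) $(\succ_i)_{i\in[n]}$ is single crossing; (ii) for every $\mathcal{X}\subseteq\mathcal{A}$ with $|\mathcal{X}|>(1-\varepsilon_a')m$, the profile $(\succ_i(\mathcal{X}))_{i\in[n]}$ is not single crossing. The error probability is over the randomness of the algorithm (including the oracle). *)

theory Defs
  imports "HOL-Probability.Probability"
begin

text \<open>A preference is a strict linear order: \<open>(x, y) \<in> r\<close> means that \<open>x\<close> is preferred to \<open>y\<close>.
  The inclusion is stated separately because \<open>strict_linear_order_on\<close> does not confine the
  relation to \<open>A\<close>.\<close>

definition preferences :: "'a set \<Rightarrow> 'a rel set" where
  "preferences A = {r. r \<subseteq> A \<times> A \<and> strict_linear_order_on A r}"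

type_synonym 'a profile = "'a rel list"

definition profiles :: "'a set \<Rightarrow> nat \<Rightarrow> 'a profile set" where
  "profiles A n = {P. length P = n \<and> set P \<subseteq> preferences A}"

definition restrict_profile :: "'a set \<Rightarrow> 'a profile \<Rightarrow> 'a profile" where
  "restrict_profile X P = map (\<lambda>r. Restr r X) P"

definition order_changes :: "'a profile \<Rightarrow> 'a \<Rightarrow> 'a \<Rightarrow> nat" where
  "order_changes S x y =
     card {i. Suc i < length S \<and> ((x, y) \<in> S ! i \<longleftrightarrow> (x, y) \<notin> S ! Suc i)}"

definition single_crossing :: "'a set \<Rightarrow> 'a profile \<Rightarrow> bool" where
  "single_crossing A P \<longleftrightarrow>
     (\<exists>S. mset S = mset P \<and> (\<forall>x\<in>A. \<forall>y\<in>A. order_changes S x y \<le> 1))"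

text \<open>The content does not depend on the names of the \<open>k\<close> alternatives; we take \<open>{..<k}\<close>.\<close>

definition con_single_crossing :: "nat \<Rightarrow> real" where
  "con_single_crossing k =
     (if k = 0 then 1
      else real (Max {card (set P) | P. set P \<subseteq> preferences {..<k} \<and> single_crossing {..<k} P})
             / fact k)"

text \<open>A deterministic adaptive algorithm is a decision tree. \<open>Draw\<close> queries the oracle. The
  agents drawn are anonymous: drawing an agent reveals nothing, and an agent is addressed
  only as the \<open>j\<close>-th one drawn so far (from \<open>0\<close>), so that the algorithm learns about it only
  through its replies. \<open>Compare j x y t u\<close> asks that agent to compare \<open>x\<close> and \<open>y\<close>, and
  continues with \<open>t\<close> if it prefers \<open>x\<close> and with \<open>u\<close> otherwise; agents drawn earlier
  may be asked again at any time.\<close>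

datatype 'a decision_tree =
    Output bool
  | Draw "'a decision_tree"
  | Compare nat 'a 'a "'a decision_tree" "'a decision_tree"

text \<open>The number \<open>d\<close> counts the agents drawn so far.\<close>

primrec valid_tree :: "'a set \<Rightarrow> nat \<Rightarrow> 'a decision_tree \<Rightarrow> bool" where
  "valid_tree A d (Output b) \<longleftrightarrow> True"
| "valid_tree A d (Draw t) \<longleftrightarrow> valid_tree A (Suc d) t"
| "valid_tree A d (Compare j x y t u) \<longleftrightarrow>
     j < d \<and> x \<in> A \<and> y \<in> A \<and> valid_tree A d t \<and> valid_tree A d u"

text \<open>The joint distribution of the output and of the number of comparison queries made, when
  \<open>ags\<close> lists the agents drawn so far.\<close>

primrec run_tree :: "'a profile \<Rightarrow> 'a decision_tree \<Rightarrow> nat list \<Rightarrow> (bool \<times> nat) pmf" where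
  "run_tree P (Output b) ags = return_pmf (b, 0)"
| "run_tree P (Draw t) ags =
     bind_pmf (pmf_of_set {..<length P}) (\<lambda>i. run_tree P t (ags @ [i]))"
| "run_tree P (Compare j x y t u) ags =
     map_pmf (apsnd Suc)
       (if (x, y) \<in> P ! (ags ! j) then run_tree P t ags else run_tree P u ags)"

text \<open>A randomized algorithm is a distribution on decision trees: all internal coins are tossed
  in advance.\<close>

type_synonym 'a algorithm = "'a decision_tree pmf"

definition valid_algorithm :: "'a set \<Rightarrow> 'a algorithm \<Rightarrow> bool" where
  "valid_algorithm A M \<longleftrightarrow> (\<forall>t\<in>set_pmf M. valid_tree A 0 t)"

definition run :: "'a algorithm \<Rightarrow> 'a profile \<Rightarrow> (bool \<times> nat) pmf" where
  "run M P = bind_pmf M (\<lambda>t. run_tree P t [])"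

definition output_prob :: "'a algorithm \<Rightarrow> 'a profile \<Rightarrow> bool \<Rightarrow> real" where
  "output_prob M P b = pmf (map_pmf fst (run M P)) b"

definition kind_i :: "'a set \<Rightarrow> nat \<Rightarrow> 'a profile set" where
  "kind_i A n = {P \<in> profiles A n. single_crossing A P}"

definition kind_ii :: "'a set \<Rightarrow> nat \<Rightarrow> real \<Rightarrow> 'a profile set" where
  "kind_ii A n \<epsilon> = {P \<in> profiles A n.
     \<forall>X\<subseteq>A. real (card X) > (1 - \<epsilon>) * real (card A) \<longrightarrow>
            \<not> single_crossing X (restrict_profile X P)}"

text \<open>The outputs \<open>1\<close> and \<open>0\<close> are rendered as \<open>True\<close> and \<open>False\<close>.\<close>

definition arbitrary_outliers_vs_arbitrary_tester ::
    "'a set \<Rightarrow> nat \<Rightarrow> real \<Rightarrow> real \<Rightarrow> 'a algorithm \<Rightarrow> bool" where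
  "arbitrary_outliers_vs_arbitrary_tester A n \<epsilon> \<delta> M \<longleftrightarrow>
     valid_algorithm A M \<and>
     (\<forall>P\<in>kind_i A n. output_prob M P False \<le> \<delta>) \<and>
     (\<forall>P\<in>kind_ii A n \<epsilon>. output_prob M P True \<le> \<delta>)"

text \<open>Worst case over the admissible inputs and over all random choices; infinite if unbounded.\<close>

definition sample_complexity :: "'a set \<Rightarrow> nat \<Rightarrow> real \<Rightarrow> 'a algorithm \<Rightarrow> enat" where
  "sample_complexity A n \<epsilon> M =
     (SUP P \<in> kind_i A n \<union> kind_ii A n \<epsilon>. SUP (b, q) \<in> set_pmf (run M P). enat q)"

end

theory Submission
  imports Defs
begin

text \<open>Hide the outliers: let all agents hold one fixed order, except that for each alternative \<open>z\<close>
  one agent moves \<open>z\<close> to the bottom and one moves \<open>z\<close> to the top. For alternatives \<open>a, b, c\<close> in the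
  fixed order, the profile then contains the orders \<open>abc\<close>, \<open>bca\<close> and \<open>cab\<close>, and whichever of
  them lies in the middle of a sequence differs from both others on some pair; so no set of at least three
  alternatives is single crossing, and the content condition guarantees three alternatives.
  Yet every pair of alternatives is reversed by a bounded number of agents, independently of \<open>m\<close>.
  Hence each comparison has only probability \<open>O(1 / n)\<close> to tell this profile from the unanimous one,
  and \<open>q\<close> comparisons all fail to do so with probability at least \<open>exp (- O(q / n))\<close>, which the
  tester can afford only if this is at most \<open>\<delta> / (1 - \<delta>)\<close>.\<close>

subsection \<open>Profiles that are not single crossing\<close>

lemma change_between:
  fixes Q :: "nat \<Rightarrow> bool"
  assumes "i < j" "Q i \<noteq> Q j"
  shows "\<exists>k\<ge>i. k < j \<and> Q k \<noteq> Q (Suc k)"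
proof (rule ccontr)
  assume no: "\<not> ?thesis"
  have "i + d \<le> j \<Longrightarrow> Q (i + d) = Q i" for d
    by (induction d) (use no in auto)
  from this[of "j - i"] assms show False by simp
qed

lemma order_changes_ge_2:
  assumes "i < j" "j < k" "k < length S"
    and "((x, y) \<in> S ! i) \<noteq> ((x, y) \<in> S ! j)" "((x, y) \<in> S ! j) \<noteq> ((x, y) \<in> S ! k)"
  shows "2 \<le> order_changes S x y"
proof -
  obtain p where p: "i \<le> p" "p < j" "((x, y) \<in> S ! p) \<noteq> ((x, y) \<in> S ! Suc p)"
    using change_between[of i j "\<lambda>i. (x, y) \<in> S ! i"] assms by blast
  obtain q where q: "j \<le> q" "q < k" "((x, y) \<in> S ! q) \<noteq> ((x, y) \<in> S ! Suc q)"
    using change_between[of j k "\<lambda>i. (x, y) \<in> S ! i"] assms by blast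
  let ?C = "{i. Suc i < length S \<and> ((x, y) \<in> S ! i \<longleftrightarrow> (x, y) \<notin> S ! Suc i)}"
  have "finite ?C" by (rule finite_subset[of _ "{..<length S}"]) auto
  moreover have "{p, q} \<subseteq> ?C" using p q assms by auto
  ultimately have "card {p, q} \<le> card ?C" by (intro card_mono)
  moreover have "p \<noteq> q" using p q by simp
  ultimately show ?thesis by (simp add: order_changes_def)
qed

text \<open>Each pair singles out one order: \<open>(a, b)\<close> sets \<open>r\<^sub>2\<close>
  apart from the other two, \<open>(b, c)\<close> sets \<open>r\<^sub>3\<close> apart, and
  \<open>(a, c)\<close> sets \<open>r\<^sub>1\<close> apart. The pair belonging to the middle order
  changes twice.\<close>

lemma cyclic_triple_not_single_crossing:
  assumes "r\<^sub>1 \<in> set P" "r\<^sub>2 \<in> set P" "r\<^sub>3 \<in> set P" and A: "a \<in> A" "b \<in> A" "c \<in> A"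
    and r1: "(a, b) \<in> r\<^sub>1" "(b, c) \<in> r\<^sub>1" "(a, c) \<in> r\<^sub>1"
    and r2: "(a, b) \<notin> r\<^sub>2" "(b, c) \<in> r\<^sub>2" "(a, c) \<notin> r\<^sub>2"
    and r3: "(a, b) \<in> r\<^sub>3" "(b, c) \<notin> r\<^sub>3" "(a, c) \<notin> r\<^sub>3"
  shows "\<not> single_crossing A P"
proof
  assume "single_crossing A P"
  then obtain S where S: "mset S = mset P" "\<And>x y. x \<in> A \<Longrightarrow> y \<in> A \<Longrightarrow> order_changes S x y \<le> 1"
    by (auto simp: single_crossing_def)
  have no: False if "x \<in> A" "y \<in> A" "i < j" "j < k" "k < length S"
    "((x, y) \<in> S ! i) \<noteq> ((x, y) \<in> S ! j)" "((x, y) \<in> S ! j) \<noteq> ((x, y) \<in> S ! k)" for x y i j k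
    using order_changes_ge_2[OF that(3-7)] S(2)[OF that(1,2)] by simp
  have "set S = set P" using S(1) by (rule mset_eq_setD)
  then obtain i j k where i: "i < length S" "S ! i = r\<^sub>1" and j: "j < length S" "S ! j = r\<^sub>2"
    and k: "k < length S" "S ! k = r\<^sub>3"
    using assms(1-3) by (metis in_set_conv_nth)
  have "i \<noteq> j" "i \<noteq> k" "j \<noteq> k" using i j k r1 r2 r3 by auto
  then consider "i < j" "j < k" | "k < j" "j < i" | "i < k" "k < j" | "j < k" "k < i"
    | "j < i" "i < k" | "k < i" "i < j" by linarith
  then show False
  proof cases
    case 1 show False using no[OF A(1,2) 1] i j k r1 r2 r3 by simp
  next case 2 show False using no[OF A(1,2) 2] i j k r1 r2 r3 by simp
  next case 3 show False using no[OF A(2,3) 3] i j k r1 r2 r3 by simp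
  next case 4 show False using no[OF A(2,3) 4] i j k r1 r2 r3 by simp
  next case 5 show False using no[OF A(1,3) 5] i j k r1 r2 r3 by simp
  next case 6 show False using no[OF A(1,3) 6] i j k r1 r2 r3 by simp
  qed
qed

lemma single_crossing_replicate: "single_crossing A (replicate n r)"
proof -
  have "order_changes (replicate n r) x y = 0" for x y
    by (simp add: order_changes_def cong: conj_cong)
  then show ?thesis unfolding single_crossing_def by (intro exI[of _ "replicate n r"]) simp
qed

lemma single_crossing_length_le_2:
  assumes "length P \<le> 2"
  shows "single_crossing A P"
proof -
  have "order_changes P x y \<le> 1" for x y
  proof -
    have "{i. Suc i < length P \<and> ((x, y) \<in> P ! i \<longleftrightarrow> (x, y) \<notin> P ! Suc i)} \<subseteq> {0}"
      using assms by auto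
    from card_mono[OF _ this] show ?thesis by (simp add: order_changes_def)
  qed
  then show ?thesis by (auto simp: single_crossing_def)
qed

text \<open>Profiles may be arbitrarily long, but their distinct entries are bounded by the number
  of preferences, so \<open>Max\<close> ranges over a finite set.\<close>

lemma con_single_crossing_ge:
  assumes "set P \<subseteq> preferences {..<k}" "single_crossing {..<k} P" "k > 0"
  shows "real (card (set P)) / fact k \<le> con_single_crossing k"
proof -
  let ?M = "{card (set P) | P. set P \<subseteq> preferences {..<k} \<and> single_crossing {..<k} P}"
  have "preferences {..<k} \<subseteq> Pow ({..<k} \<times> {..<k})" by (auto simp: preferences_def)
  then have fin: "finite (preferences {..<k})" by (rule finite_subset) simp
  have "?M \<subseteq> {..card (preferences {..<k})}" using fin by (auto intro: card_mono)
  then have "finite ?M" by (rule finite_subset) simp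
  then have "card (set P) \<le> Max ?M" using assms by (intro Max_ge) auto
  then show ?thesis using assms by (simp add: con_single_crossing_def divide_right_mono)
qed

text \<open>For one or two alternatives a profile of length at most two already contains all
  \<open>k!\<close> preferences; \<open>k = 0\<close> is settled by the convention.\<close>

lemma con_single_crossing_less_1_imp:
  assumes "con_single_crossing k < 1"
  shows "3 \<le> k"
proof (rule ccontr)
  assume "\<not> 3 \<le> k"
  then consider "k = 0" | "k = 1" | "k = 2" by linarith
  then show False
  proof cases
    case 1 then show False using assms by (simp add: con_single_crossing_def)
  next
    case 2
    have "set [{}] \<subseteq> preferences {..<k}"
      using 2 by (auto simp: preferences_def strict_linear_order_on_def irrefl_def total_on_def)
    from con_single_crossing_ge[OF this single_crossing_length_le_2] 2 assms show False by simp
  next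
    case 3
    have "set [{(0, 1)}, {(1, 0)}] \<subseteq> preferences {..<k}"
      using 3 by (auto simp: preferences_def strict_linear_order_on_def irrefl_def total_on_def
          trans_def less_2_cases_iff)
    from con_single_crossing_ge[OF this single_crossing_length_le_2] 3 assms show False by simp
  qed
qed

subsection \<open>The hidden outliers\<close>

text \<open>Smaller rank means more preferred. Ranks are integers so that \<open>-1\<close> can
  place an alternative ahead of all others.\<close>

definition order_by :: "'a set \<Rightarrow> ('a \<Rightarrow> int) \<Rightarrow> 'a rel" where
  "order_by A g = {(x, y). x \<in> A \<and> y \<in> A \<and> g x < g y}"

lemma order_by_in_preferences:
  assumes "inj_on g A"
  shows "order_by A g \<in> preferences A"
proof -
  have "g x < g y \<or> g y < g x" if "x \<in> A" "y \<in> A" "x \<noteq> y" for x y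
    using inj_on_contraD[OF assms that(3,1,2)] by linarith
  then show ?thesis
    by (auto simp: preferences_def order_by_def strict_linear_order_on_def trans_def irrefl_def
        total_on_def)
qed

definition hidden_outliers :: "'a list \<Rightarrow> ('a \<Rightarrow> int) \<Rightarrow> nat \<Rightarrow> 'a profile" where
  "hidden_outliers zs f n =
     map (\<lambda>z. order_by (set zs) (f(z := int (length zs)))) zs @
     map (\<lambda>z. order_by (set zs) (f(z := -1))) zs @
     replicate (n - 2 * length zs) (order_by (set zs) f)"

text \<open>The range of \<open>f\<close> leaves the ranks \<open>-1\<close> and
  \<open>length zs\<close> free for the two kinds of moves. The strict bound on \<open>n\<close>
  leaves at least one agent with the unmodified order.\<close>

locale ranked_alternatives =
  fixes zs :: "'a list" and f :: "'a \<Rightarrow> int" and n :: nat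
  assumes distinct: "distinct zs"
    and inj: "inj_on f (set zs)"
    and range: "z \<in> set zs \<Longrightarrow> 0 \<le> f z \<and> f z < int (length zs)"
    and n: "2 * length zs < n"
begin

lemma hidden_outliers_in_profiles: "hidden_outliers zs f n \<in> profiles (set zs) n"
proof -
  have "inj_on (f(z := int (length zs))) (set zs)" "inj_on (f(z := -1)) (set zs)" for z
    using inj range by (fastforce simp: inj_on_def)+
  with inj n show ?thesis
    by (auto simp: hidden_outliers_def profiles_def intro!: order_by_in_preferences)
qed

lemma hidden_outliers_not_single_crossing:
  assumes X: "X \<subseteq> set zs" and "3 \<le> card X"
  shows "\<not> single_crossing X (restrict_profile X (hidden_outliers zs f n))"
proof -
  \<comment> \<open>Choosing three ranks rather than three alternatives lets minimum, maximum and
    the remaining element supply them in sorted order.\<close>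
  obtain Y where Y: "Y \<subseteq> f ` X" "card Y = 3"
    using assms inj by (metis card_image inj_on_subset obtain_subset_with_card_n)
  define u where "u = Min Y"
  define w where "w = Max Y"
  have finY: "finite Y" "Y \<noteq> {}" using Y(2) by (auto intro: card_ge_0_finite)
  have "card {u, w} < card Y" using Y(2) by (auto simp: card_insert_if)
  then have "\<not> Y \<subseteq> {u, w}" by (meson card_mono finite.emptyI finite.insertI leD)
  then obtain v where v: "v \<in> Y" "v \<noteq> u" "v \<noteq> w" by auto
  have "u \<in> Y" "w \<in> Y" using finY by (simp_all add: u_def w_def)
  then have "u < v" "v < w" using finY v by (auto simp: u_def w_def less_le)
  moreover have "u \<in> f ` X" "v \<in> f ` X" "w \<in> f ` X"
    using Y(1) \<open>u \<in> Y\<close> \<open>w \<in> Y\<close> v(1) by auto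
  ultimately obtain a b c where abc: "a \<in> X" "b \<in> X" "c \<in> X" "f a < f b" "f b < f c"
    by blast
  have ne: "a \<noteq> b" "b \<noteq> c" "a \<noteq> c" using abc by auto
  have zs: "a \<in> set zs" "b \<in> set zs" "c \<in> set zs" using abc X by auto
  let ?R = "\<lambda>g. Restr (order_by (set zs) g) X"
  show ?thesis
  \<comment> \<open>The order \<open>abc\<close> is the fixed one, \<open>bca\<close> arises by
    moving \<open>a\<close> to the bottom, and \<open>cab\<close> by moving \<open>c\<close> to the
    top.\<close>
  proof (rule cyclic_triple_not_single_crossing[of "?R f" _ "?R (f(a := int (length zs)))"
          "?R (f(c := -1))"])
    show "?R f \<in> set (restrict_profile X (hidden_outliers zs f n))"
      "?R (f(a := int (length zs))) \<in> set (restrict_profile X (hidden_outliers zs f n))"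
      "?R (f(c := -1)) \<in> set (restrict_profile X (hidden_outliers zs f n))"
      using zs n by (auto simp: restrict_profile_def hidden_outliers_def)
    show "a \<in> X" "b \<in> X" "c \<in> X" by fact+
  qed (use abc zs ne range[OF zs(1)] range[OF zs(2)] range[OF zs(3)]
      in \<open>auto simp: order_by_def\<close>)
qed

text \<open>Moving \<open>z\<close> affects only pairs containing \<open>z\<close>. Hence only the
  agents for \<open>z = x\<close> and \<open>z = y\<close> can disagree, at most two in each of the
  two blocks of moved alternatives.\<close>

lemma card_disagreeing_le:
  assumes "x \<in> set zs" "y \<in> set zs"
  shows "card {i. i < n \<and> ((x, y) \<in> hidden_outliers zs f n ! i) \<noteq> ((x, y) \<in> order_by (set zs) f)}
    \<le> 4"
proof -
  let ?Q = "\<lambda>r. ((x, y) \<in> r) \<noteq> ((x, y) \<in> order_by (set zs) f)"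
  have len: "length (hidden_outliers zs f n) = n" using n by (simp add: hidden_outliers_def)
  have "length (filter (\<lambda>z. ?Q (order_by (set zs) (f(z := v)))) zs) \<le> 2" for v
  proof -
    have "length (filter (\<lambda>z. ?Q (order_by (set zs) (f(z := v)))) zs) =
        card (set (filter (\<lambda>z. ?Q (order_by (set zs) (f(z := v)))) zs))"
      using distinct by (simp only: distinct_card distinct_filter)
    also have "\<dots> \<le> card {x, y}"
      by (intro card_mono) (auto simp: order_by_def split: if_splits)
    also have "\<dots> \<le> 2" by (simp add: card_insert_if)
    finally show ?thesis .
  qed
  from this[of "int (length zs)"] this[of "-1"]
  have "length (filter ?Q (hidden_outliers zs f n)) \<le> 4"
    by (simp add: hidden_outliers_def comp_def filter_map)
  then show ?thesis by (simp only: length_filter_conv_card len)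
qed

lemma card_agreeing_ge:
  "n - 2 * length zs \<le> card {i. i < n \<and> hidden_outliers zs f n ! i = order_by (set zs) f}"
proof -
  let ?P = "hidden_outliers zs f n"
  have len: "length ?P = n" using n by (simp add: hidden_outliers_def)
  have "n - 2 * length zs \<le> length (filter (\<lambda>r. r = order_by (set zs) f) ?P)"
    by (simp add: hidden_outliers_def)
  then show ?thesis by (simp only: length_filter_conv_card len)
qed

end

subsection \<open>Decision trees on unanimous and on almost unanimous profiles\<close>

text \<open>When all agents hold \<open>r\<close>, it does not matter who is drawn, so the tree
  follows a single path and the run is deterministic.\<close>

primrec unanimous_run :: "'a rel \<Rightarrow> 'a decision_tree \<Rightarrow> bool \<times> nat" where
  "unanimous_run r (Output b) = (b, 0)"
| "unanimous_run r (Draw t) = unanimous_run r t"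
| "unanimous_run r (Compare j x y t u) =
     apsnd Suc (if (x, y) \<in> r then unanimous_run r t else unanimous_run r u)"

lemma run_tree_replicate:
  assumes "valid_tree A (length ags) t" "set ags \<subseteq> {..<n}" "n > 0"
  shows "run_tree (replicate n r) t ags = return_pmf (unanimous_run r t)"
  using assms
proof (induction t arbitrary: ags)
  case (Draw t)
  have "run_tree (replicate n r) (Draw t) ags =
      bind_pmf (pmf_of_set {..<n}) (\<lambda>i. return_pmf (unanimous_run r t))"
    unfolding run_tree.simps length_replicate
    by (intro bind_pmf_cong refl Draw.IH) (use Draw.prems in \<open>auto simp: lessThan_empty_iff\<close>)
  then show ?case by simp
next
  case (Compare j x y t u)
  then have "ags ! j < n" by (auto simp: subset_iff)
  with Compare show ?case by simp
qed simp

lemma run_replicate: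
  assumes "valid_algorithm A M" "n > 0"
  shows "run M (replicate n r) = map_pmf (unanimous_run r) M"
  unfolding run_def map_pmf_def
  by (intro bind_pmf_cong refl run_tree_replicate) (use assms in \<open>auto simp: valid_algorithm_def\<close>)

text \<open>The Cartesian product of the sets, as lists. It is extended on the right below because
  \<open>run_tree\<close> appends each drawn agent.\<close>

definition choices :: "nat set list \<Rightarrow> nat list set" where
  "choices Gs = {xs. list_all2 (\<in>) xs Gs}"

lemma choices_Nil: "choices [] = {[]}"
  by (auto simp: choices_def)

lemma choices_snoc: "choices (Gs @ [G]) = (\<lambda>(xs, x). xs @ [x]) ` (choices Gs \<times> G)"
proof (intro equalityI subsetI)
  fix ys assume "ys \<in> choices (Gs @ [G])"
  then obtain xs x where "ys = xs @ [x]" "list_all2 (\<in>) xs Gs" "x \<in> G"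
    by (auto simp: choices_def list_all2_append2 list_all2_Cons2)
  then show "ys \<in> (\<lambda>(xs, x). xs @ [x]) ` (choices Gs \<times> G)"
    by (auto simp: choices_def)
qed (auto simp: choices_def intro: list_all2_appendI)

lemma sum_choices_snoc:
  "(\<Sum>xs\<in>choices (Gs @ [G]). h xs) = (\<Sum>xs\<in>choices Gs. \<Sum>x\<in>G. h (xs @ [x]))"
proof -
  have "inj_on (\<lambda>(xs, x). xs @ [x]) (choices Gs \<times> G)" by (auto simp: inj_on_def)
  then show ?thesis
    by (simp add: choices_snoc sum.reindex sum.cartesian_product case_prod_unfold)
qed

lemma card_choices: "card (choices Gs) = prod_list (map card Gs)"
proof (induction Gs rule: rev_induct)
  case (snoc G Gs)
  have "inj_on (\<lambda>(xs, x). xs @ [x]) (choices Gs \<times> G)" by (auto simp: inj_on_def)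
  with snoc show ?case by (simp add: choices_snoc card_image card_cartesian_product)
qed (simp add: choices_Nil)

lemma finite_choices: "(\<And>G. G \<in> set Gs \<Longrightarrow> finite G) \<Longrightarrow> finite (choices Gs)"
  by (induction Gs rule: rev_induct) (auto simp: choices_Nil choices_snoc)

text \<open>The sets \<open>Gs\<close> collect, for each agent drawn, the identities that are consistent with replies
  like those of a unanimous profile. Counting over all choices from these sets instead of
  conditioning on the replies keeps the drawn agents independent.\<close>

lemma sum_pmf_run_tree_ge:
  fixes P :: "'a profile" and r :: "'a rel" and K L :: nat
  defines "n \<equiv> length P"
  defines "H \<equiv> {i. i < n \<and> P ! i = r}"
  assumes K: "\<And>x y. x \<in> A \<Longrightarrow> y \<in> A \<Longrightarrow>
      card {i. i < n \<and> ((x, y) \<in> P ! i) \<noteq> ((x, y) \<in> r)} \<le> K"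
    and L: "L \<le> card H" "K \<le> L" "0 < L"
    and "valid_tree A (length Gs) t" "\<And>G. G \<in> set Gs \<Longrightarrow> H \<subseteq> G \<and> G \<subseteq> {..<n}"
  shows "(1 - real K / real L) ^ snd (unanimous_run r t) * real (card (choices Gs))
    \<le> (\<Sum>ags\<in>choices Gs. pmf (map_pmf fst (run_tree P t ags)) (fst (unanimous_run r t)))"
  using assms(7-)
proof (induction t arbitrary: Gs)
  case (Output b)
  then show ?case by simp
next
  case (Draw t)
  have "card H \<le> card {..<n}" by (intro card_mono) (auto simp: H_def)
  then have n: "n > 0" using L by simp
  let ?b = "fst (unanimous_run r t)"
  have eq: "pmf (map_pmf fst (run_tree P (Draw t) ags)) ?b =
      (\<Sum>i<n. pmf (map_pmf fst (run_tree P t (ags @ [i]))) ?b) / n" for ags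
    using n by (simp add: map_bind_pmf pmf_bind_pmf_of_set n_def lessThan_empty_iff)
  \<comment> \<open>A new agent may be anyone. The factor \<open>n\<close> in the number of choices
    cancels the probability \<open>1 / n\<close> of each draw.\<close>
  have "(1 - real K / real L) ^ snd (unanimous_run r t) * real (card (choices (Gs @ [{..<n}])))
    \<le> (\<Sum>ags\<in>choices (Gs @ [{..<n}]). pmf (map_pmf fst (run_tree P t ags)) ?b)"
    using Draw.prems by (intro Draw.IH) (auto simp: H_def)
  with n show ?case
    unfolding unanimous_run.simps eq
    by (simp add: sum_choices_snoc card_choices field_simps flip: sum_divide_distrib)
next
  case (Compare j x y t u)
  from Compare.prems have j: "j < length Gs" and xy: "x \<in> A" "y \<in> A" by auto
  \<comment> \<open>The agents in \<open>B\<close> would reply unlike \<open>r\<close>. Removing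
    them from the \<open>j\<close>-th set keeps the run on the unanimous path.\<close>
  define B where "B = {i. i < n \<and> ((x, y) \<in> P ! i) \<noteq> ((x, y) \<in> r)}"
  define G where "G = Gs ! j"
  define Gs' where "Gs' = Gs[j := G - B]"
  define s where "s = (if (x, y) \<in> r then t else u)"
  let ?b = "fst (unanimous_run r s)" and ?q = "snd (unanimous_run r s)"
  let ?\<eta> = "1 - real K / real L"
  have G: "H \<subseteq> G" "G \<subseteq> {..<n}" using Compare.prems j by (auto simp: G_def)
  have Gs': "H \<subseteq> G' \<and> G' \<subseteq> {..<n}" if "G' \<in> set Gs'" for G'
  proof -
    from that have "G' \<in> insert (G - B) (set Gs)"
      using set_update_subset_insert unfolding Gs'_def by fast
    then show ?thesis using Compare.prems(2)[of G'] G by (auto simp: H_def B_def)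
  qed
  have fin: "finite (choices Gs)"
    by (rule finite_choices) (use Compare.prems finite_subset in blast)
  have sub: "choices Gs' \<subseteq> choices Gs"
    using j by (auto simp: choices_def Gs'_def G_def list_all2_conv_all_nth nth_list_update
        split: if_splits)
  have finG: "finite G" using G finite_subset by blast
  \<comment> \<open>Agents in \<open>H\<close> hold \<open>r\<close> and are never removed, so the
    set keeps at least \<open>L\<close> elements however often agent \<open>j\<close> has been
    asked. Losing at most \<open>K\<close> of them costs at most the fraction
    \<open>K / L\<close>.\<close>
  have "L \<le> card G" using L(1) card_mono[OF finG G(1)] by simp
  then have "real K \<le> real K / real L * real (card G)"
    using L by (simp add: field_simps mult_left_mono)
  moreover have "real (card G) - real K \<le> real (card (G - B))"
    using diff_card_le_card_Diff[of B G] K[OF xy] by (simp add: B_def)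
  ultimately have card_G: "?\<eta> * real (card G) \<le> real (card (G - B))"
    by (simp add: algebra_simps)
  have "?\<eta> * real (card (choices Gs)) \<le> real (card (choices Gs'))"
  proof -
    have 1: "prod_list (map card Gs) =
        prod_list (map card (take j Gs)) * (card G * prod_list (map card (drop (Suc j) Gs)))"
      using j by (subst id_take_nth_drop[OF j]) (simp add: G_def)
    have 2: "prod_list (map card Gs') =
        prod_list (map card (take j Gs)) * (card (G - B) * prod_list (map card (drop (Suc j) Gs)))"
      using j by (simp add: Gs'_def upd_conv_take_nth_drop)
    let ?R = "prod_list (map card (take j Gs)) * prod_list (map card (drop (Suc j) Gs))"
    have "?\<eta> * real (card G) * real ?R \<le> real (card (G - B)) * real ?R"
      by (intro mult_right_mono card_G) simp
    then show ?thesis unfolding card_choices 1 2 by (simp add: algebra_simps)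
  qed
  \<comment> \<open>The comparison pays for one factor \<open>?\<eta>\<close>; it is nonnegative
    because \<open>K \<le> L\<close>.\<close>
  then have "?\<eta> ^ Suc ?q * real (card (choices Gs)) \<le> ?\<eta> ^ ?q * real (card (choices Gs'))"
    using L by (simp add: mult.assoc mult.left_commute[of ?\<eta>] mult_left_mono)
  also have "\<dots> \<le> (\<Sum>ags\<in>choices Gs'. pmf (map_pmf fst (run_tree P s ags)) ?b)"
    using Compare.prems Gs' by (auto simp: s_def Gs'_def intro!: Compare.IH)
  also have "\<dots> = (\<Sum>ags\<in>choices Gs'. pmf (map_pmf fst (run_tree P (Compare j x y t u) ags)) ?b)"
  proof (intro sum.cong refl)
    fix ags assume "ags \<in> choices Gs'"
    then have "ags ! j \<in> G - B"
      using j by (auto simp: choices_def Gs'_def list_all2_conv_all_nth)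
    then have "((x, y) \<in> P ! (ags ! j)) = ((x, y) \<in> r)"
      using G by (auto simp: B_def)
    then show "pmf (map_pmf fst (run_tree P s ags)) ?b =
        pmf (map_pmf fst (run_tree P (Compare j x y t u) ags)) ?b"
      by (simp add: s_def pmf.map_comp comp_def)
  qed
  \<comment> \<open>The discarded choices contribute nonnegative probabilities.\<close>
  also have "\<dots> \<le> (\<Sum>ags\<in>choices Gs. pmf (map_pmf fst (run_tree P (Compare j x y t u) ags)) ?b)"
    by (intro sum_mono2 fin sub) simp
  finally show ?case by (cases "(x, y) \<in> r") (simp_all add: s_def)
qed

text \<open>The counting bound is applied to each tree with no agent drawn yet, where the empty list
  is the only choice, and then averaged over the trees. Trees with another output on the unanimous
  profile are bounded by \<open>0\<close>.\<close>

lemma output_prob_almost_unanimous_ge: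
  fixes P :: "'a profile" and r :: "'a rel" and K L Q :: nat
  assumes M: "valid_algorithm A M"
    and K: "\<And>x y. x \<in> A \<Longrightarrow> y \<in> A \<Longrightarrow>
      card {i. i < length P \<and> ((x, y) \<in> P ! i) \<noteq> ((x, y) \<in> r)} \<le> K"
    and L: "L \<le> card {i. i < length P \<and> P ! i = r}" "K \<le> L" "0 < L"
    and Q: "\<And>b q. (b, q) \<in> set_pmf (run M (replicate (length P) r)) \<Longrightarrow> q \<le> Q"
  shows "(1 - real K / real L) ^ Q * output_prob M (replicate (length P) r) b
    \<le> output_prob M P b"
proof -
  let ?\<eta> = "1 - real K / real L"
  have "P \<noteq> []" using L by auto
  then have run0: "run M (replicate (length P) r) = map_pmf (unanimous_run r) M"
    using M by (intro run_replicate) auto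
  have \<eta>: "0 \<le> ?\<eta>" "?\<eta> \<le> 1" using L by auto
  have "?\<eta> ^ Q * output_prob M (replicate (length P) r) b
      = measure_pmf.expectation M (\<lambda>t. ?\<eta> ^ Q * indicator {t. fst (unanimous_run r t) = b} t)"
    by (simp add: output_prob_def run0 pmf.map_comp pmf_map vimage_def)
  also have "\<dots> \<le> measure_pmf.expectation M (\<lambda>t. pmf (map_pmf fst (run_tree P t [])) b)"
  proof (intro integral_mono_AE)
    show "integrable (measure_pmf M) (\<lambda>t. ?\<eta> ^ Q * indicator {t. fst (unanimous_run r t) = b} t)"
      by (intro integrable_mult_right measure_pmf.integrable_const_bound[of _ 1])
        (auto simp: indicator_def)
    show "integrable (measure_pmf M) (\<lambda>t. pmf (map_pmf fst (run_tree P t [])) b)"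
      by (intro measure_pmf.integrable_const_bound[of _ 1]) (auto simp: pmf_le_1)
    show "AE t in measure_pmf M. ?\<eta> ^ Q * indicator {t. fst (unanimous_run r t) = b} t
        \<le> pmf (map_pmf fst (run_tree P t [])) b"
    proof (rule AE_pmfI)
      fix t assume t: "t \<in> set_pmf M"
      show "?\<eta> ^ Q * indicator {t. fst (unanimous_run r t) = b} t
        \<le> pmf (map_pmf fst (run_tree P t [])) b"
      proof (cases "fst (unanimous_run r t) = b")
        case True
        have "unanimous_run r t \<in> set_pmf (run M (replicate (length P) r))"
          using t by (simp add: run0)
        then have "snd (unanimous_run r t) \<le> Q"
          using Q[of "fst (unanimous_run r t)" "snd (unanimous_run r t)"] by simp
        \<comment> \<open>The worst-case number \<open>Q\<close> replaces the number of comparisons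
          on the path of \<open>t\<close>, making the factor the same for all trees.\<close>
        then have "?\<eta> ^ Q \<le> ?\<eta> ^ snd (unanimous_run r t)"
          using \<eta> by (rule power_decreasing)
        also have "\<dots> \<le> pmf (map_pmf fst (run_tree P t [])) b"
          using sum_pmf_run_tree_ge[where Gs = "[]" and t = t, OF K L] M t True
          by (simp add: valid_algorithm_def choices_Nil)
        finally show ?thesis using True by simp
      qed simp
    qed
  qed
  also have "\<dots> = output_prob M P b"
    by (simp add: output_prob_def run_def map_bind_pmf pmf_bind)
  finally show ?thesis .
qed

subsection \<open>The lower bound\<close>

text \<open>This follows from \<open>ln (1 - x) \<ge> - x - 2 * x\<^sup>2\<close>, since
  \<open>2 * x\<^sup>2 \<le> x\<close> in this range.\<close>

lemma exp_le_one_minus: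
  fixes x :: real
  assumes "0 \<le> x" "x \<le> 1 / 2"
  shows "exp (- 2 * x) \<le> 1 - x"
proof -
  have "2 * x\<^sup>2 \<le> x"
    using mult_left_mono[OF assms(2,1)] by (simp add: power2_eq_square)
  then have "- 2 * x \<le> ln (1 - x)"
    using ln_one_minus_pos_lower_bound[OF assms] by simp
  then have "exp (- 2 * x) \<le> exp (ln (1 - x))" by (simp only: exp_le_cancel_iff)
  with assms show ?thesis by simp
qed

text \<open>The quotient of the two logarithms is
  \<open>1 - ln (1 - \<delta>) / ln \<delta>\<close>, which decreases in \<open>\<delta>\<close>;
  the factor is its value at \<open>\<delta>0\<close>.\<close>

lemma ln_odds_ge:
  fixes \<delta> \<delta>0 :: real
  assumes "0 < \<delta>" "\<delta> \<le> \<delta>0" "\<delta>0 < 1 / 2"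
  shows "(1 - ln (1 - \<delta>0) / ln \<delta>0) * ln (1 / \<delta>) \<le> ln ((1 - \<delta>) / \<delta>)"
proof -
  have neg: "ln \<delta> < 0" "ln \<delta>0 < 0" "ln (1 - \<delta>0) < 0" using assms by auto
  have "ln \<delta> \<le> ln \<delta>0" using assms by simp
  then have "1 \<le> ln \<delta> / ln \<delta>0" using neg by (simp add: le_divide_eq)
  then have "ln (1 - \<delta>0) / ln \<delta>0 * ln \<delta> \<le> ln (1 - \<delta>0)"
    using neg mult_left_mono_neg[of 1 "ln \<delta> / ln \<delta>0" "ln (1 - \<delta>0)"] by simp
  also have "\<dots> \<le> ln (1 - \<delta>)" using assms by simp
  finally show ?thesis using assms by (simp add: ln_div algebra_simps)
qed

text \<open>On the unanimous profile the tester outputs \<open>True\<close> with probability at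
  least \<open>1 - \<delta>\<close>, and on the hidden outliers with probability at most
  \<open>\<delta>\<close>. Since \<open>Q\<close> comparisons shrink this probability by a factor no
  smaller than \<open>(1 - 4 / (n - 2 * m)) ^ Q\<close>, \<open>Q\<close> must be large.\<close>

lemma query_bound:
  assumes A: "finite A" "card A = m" and n_ge: "4 * m + 16 \<le> n" and "0 < \<epsilon>" "\<epsilon> \<le> 1"
    and \<delta>: "0 < \<delta>" "\<delta> < 1"
    and con: "con_single_crossing (nat \<lceil>(1 - \<epsilon>) * real m\<rceil>) < 1"
    and M: "arbitrary_outliers_vs_arbitrary_tester A n \<epsilon> \<delta> M"
    and Q: "sample_complexity A n \<epsilon> M = enat Q"
  shows "real n * ln ((1 - \<delta>) / \<delta>) \<le> 16 * real Q"
proof -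
  obtain zs where zs: "set zs = A" "distinct zs" using A finite_distinct_list by blast
  then have len: "length zs = m" using A distinct_card[OF zs(2)] by simp
  obtain g where g: "bij_betw g A {0..<m}"
    using ex_bij_betw_finite_nat[OF A(1)] A(2) by auto
  define f where "f z = int (g z)" for z
  interpret ranked_alternatives zs f n
  proof
    show "inj_on f (set zs)" using g zs by (auto simp: bij_betw_def inj_on_def f_def)
    show "0 \<le> f z \<and> f z < int (length zs)" if "z \<in> set zs" for z
      using that g zs len by (auto simp: f_def dest: bij_betwE)
  qed (use zs len n_ge in auto)
  define r where "r = order_by A f"
  define P where "P = hidden_outliers zs f n"
  have P: "P \<in> profiles A n" using hidden_outliers_in_profiles by (simp add: P_def zs)
  then have lenP: "length P = n" by (simp add: profiles_def)
  have kind_i: "replicate n r \<in> kind_i A n"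
    using order_by_in_preferences[OF inj]
    by (auto simp: kind_i_def profiles_def r_def zs single_crossing_replicate)
  have kind_ii: "P \<in> kind_ii A n \<epsilon>"
    unfolding kind_ii_def
  proof (intro CollectI conjI P allI impI)
    fix X assume X: "X \<subseteq> A" "(1 - \<epsilon>) * real (card A) < real (card X)"
    \<comment> \<open>An integer above a real number is at least its ceiling, so the content
      condition gives three alternatives in \<open>X\<close>.\<close>
    then have "nat \<lceil>(1 - \<epsilon>) * real m\<rceil> \<le> card X"
      using A by (simp add: ceiling_le_iff nat_le_iff)
    with con_single_crossing_less_1_imp[OF con] have "3 \<le> card X" by (rule le_trans)
    with X show "\<not> single_crossing X (restrict_profile X P)"
      using hidden_outliers_not_single_crossing by (simp add: P_def zs)
  qed
  let ?L = "n - 2 * m"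
  let ?\<eta> = "4 / real ?L"
  \<comment> \<open>The bound \<open>4 * m + 16 \<le> n\<close> makes the \<open>2 * m\<close>
    outliers at most half of the agents, and keeps \<open>?\<eta>\<close> at most
    \<open>1 / 2\<close>, as \<open>exp_le_one_minus\<close> requires.\<close>
  have L: "real n \<le> 2 * real ?L" "16 \<le> n" using n_ge by auto
  then have \<eta>: "?\<eta> \<le> 8 / real n" "?\<eta> \<le> 1 / 2" by (simp_all add: field_simps)
  have valid: "valid_algorithm A M"
    using M by (simp add: arbitrary_outliers_vs_arbitrary_tester_def)
  have "q \<le> Q" if "(b, q) \<in> set_pmf (run M (replicate n r))" for b q
  proof -
    have "enat q \<le> (SUP (b, q) \<in> set_pmf (run M (replicate n r)). enat q)"
      using that by (intro SUP_upper2[where i = "(b, q)"]) auto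
    also have "\<dots> \<le> sample_complexity A n \<epsilon> M"
      unfolding sample_complexity_def using kind_i by (intro SUP_upper) auto
    finally show ?thesis by (simp add: Q)
  qed
  then have ge: "(1 - ?\<eta>) ^ Q * output_prob M (replicate n r) True \<le> output_prob M P True"
    using output_prob_almost_unanimous_ge[OF valid, of P r 4 ?L Q True]
      card_disagreeing_le[folded P_def, unfolded zs, folded r_def]
      card_agreeing_ge[folded P_def, unfolded zs len, folded r_def] n_ge
    unfolding lenP by simp
  have "output_prob M (replicate n r) True + output_prob M (replicate n r) False = 1"
    using sum_pmf_eq_1[of UNIV "map_pmf fst (run M (replicate n r))", OF _ subset_UNIV]
    by (simp add: output_prob_def UNIV_bool add.commute)
  moreover have "output_prob M (replicate n r) False \<le> \<delta>"
    using M kind_i by (auto simp: arbitrary_outliers_vs_arbitrary_tester_def)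
  ultimately have "1 - \<delta> \<le> output_prob M (replicate n r) True" by simp
  moreover have "output_prob M P True \<le> \<delta>"
    using M kind_ii by (auto simp: arbitrary_outliers_vs_arbitrary_tester_def)
  moreover have "0 \<le> (1 - ?\<eta>) ^ Q" using \<eta> by simp
  ultimately have *: "(1 - ?\<eta>) ^ Q * (1 - \<delta>) \<le> \<delta>"
    using ge mult_left_mono[of "1 - \<delta>" "output_prob M (replicate n r) True" "(1 - ?\<eta>) ^ Q"]
    by linarith
  have "exp (- (16 * real Q / real n)) = exp (- (16 / real n)) ^ Q"
    by (simp flip: exp_of_nat_mult)
  also have "\<dots> \<le> (1 - ?\<eta>) ^ Q"
  proof (rule power_mono)
    \<comment> \<open>The constant \<open>16\<close> is twice the \<open>8\<close> in the bound on
      \<open>?\<eta>\<close>.\<close>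
    have "exp (- (16 / real n)) \<le> exp (- 2 * ?\<eta>)" using \<eta> by simp
    also have "\<dots> \<le> 1 - ?\<eta>" using \<eta> by (intro exp_le_one_minus) auto
    finally show "exp (- (16 / real n)) \<le> 1 - ?\<eta>" .
  qed simp
  finally have "exp (- (16 * real Q / real n)) * (1 - \<delta>) \<le> \<delta>"
    using * \<delta> by (meson diff_ge_0_iff_ge less_imp_le mult_right_mono order_trans)
  then have "(1 - \<delta>) / \<delta> \<le> exp (16 * real Q / real n)"
    using \<delta> by (simp add: exp_minus field_simps)
  then have "ln ((1 - \<delta>) / \<delta>) \<le> 16 * real Q / real n"
    using \<delta> ln_mono[of "(1 - \<delta>) / \<delta>"] by fastforce
  then show ?thesis using L by (simp add: field_simps)
qed

text \<open>The constant depends only on \<open>\<delta>0\<close>, while the threshold for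
  \<open>n\<close> grows with \<open>m\<close> so that the outliers fit. Bounding
  \<open>\<delta>\<close> away from \<open>1 / 2\<close> keeps
  \<open>ln ((1 - \<delta>) / \<delta>)\<close> comparable to
  \<open>ln (1 / \<delta>)\<close>.\<close>

theorem theorem3p14:
  fixes \<delta>0 :: real
  assumes "\<delta>0 < 1 / 2"
  shows "\<exists>c::real. c > 0 \<and>
    (\<forall>m::nat. \<exists>N::nat. \<forall>n\<ge>N. \<forall>(A :: 'a set) (\<epsilon>::real) (\<delta>::real) (M :: 'a algorithm).
       finite A \<and> card A = m \<and> 0 < \<epsilon> \<and> \<epsilon> \<le> 1 \<and> 0 < \<delta> \<and> \<delta> \<le> \<delta>0 \<and>
       con_single_crossing (nat \<lceil>(1 - \<epsilon>) * real m\<rceil>) < 1 \<and>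
       arbitrary_outliers_vs_arbitrary_tester A n \<epsilon> \<delta> M \<longrightarrow>
       ereal (c * (real n * ln (1 / \<delta>))) \<le> ereal_of_enat (sample_complexity A n \<epsilon> M))"
proof (cases "0 < \<delta>0")
  case False
  \<comment> \<open>No \<open>\<delta>\<close> is admissible here, so any positive constant
    serves.\<close>
  then show ?thesis by (intro exI[of _ 1]) auto
next
  case True
  define c where "c = (1 - ln (1 - \<delta>0) / ln \<delta>0) / 16"
  \<comment> \<open>Positivity of \<open>c\<close> is where \<open>\<delta>0 < 1 / 2\<close>, that
    is \<open>\<delta>0 < 1 - \<delta>0\<close>, enters.\<close>
  have "ln \<delta>0 < ln (1 - \<delta>0)" "ln \<delta>0 < 0" using True assms by auto
  then have "c > 0" by (simp add: c_def divide_less_eq)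
  moreover have "ereal (c * (real n * ln (1 / \<delta>))) \<le> ereal_of_enat (sample_complexity A n \<epsilon> M)"
    if n: "4 * m + 16 \<le> n" and H: "finite A" "card A = m" "0 < \<epsilon>" "\<epsilon> \<le> 1" "0 < \<delta>" "\<delta> \<le> \<delta>0"
      "con_single_crossing (nat \<lceil>(1 - \<epsilon>) * real m\<rceil>) < 1"
      "arbitrary_outliers_vs_arbitrary_tester A n \<epsilon> \<delta> M"
    for m n and A :: "'a set" and \<epsilon> \<delta> M
  proof (cases "sample_complexity A n \<epsilon> M")
    case (enat Q)
    have "c * (real n * ln (1 / \<delta>)) = real n * ((1 - ln (1 - \<delta>0) / ln \<delta>0) * ln (1 / \<delta>)) / 16"
      by (simp add: c_def)
    also have "\<dots> \<le> real n * ln ((1 - \<delta>) / \<delta>) / 16"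
      using ln_odds_ge[OF H(5,6) assms] by (intro divide_right_mono mult_left_mono) auto
    also have "\<dots> \<le> real Q"
      using query_bound[OF H(1,2) n H(3-5) _ H(7,8) enat] H(6) assms by simp
    finally show ?thesis by (simp add: enat)
  qed simp
  ultimately show ?thesis by blast
qed

end
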